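(* Let $f:\mathbb{R}\to\mathbb{R}$ be continuous with $\lim_{|x|\to\infty} f(x)/x=0$, let $k=(k(n))_{n\ge 0}$ be a real sequence with $\sum_{j=0}^\infty |k(j)|<+\infty$, let $(H(n))_{n\ge 1}$ be a real sequence, let $\xi\in\mathbb{R}$, and let $(x(n))_{n\ge 0}$ be the real sequence defined by $x(0)=\xi$ and $$x(n+1)=H(n+1)+\sum_{j=0}^n k(n-j)f(x(j)),\quad n\ge 0.$$ Suppose that $\lim_{n\to\infty}\max_{1\le j\le n}|H(j)|=+\infty$. Then: (i) $\lim_{n\to\infty}\max_{0\le j\le n}|x(j)|=\infty$ and $$\lim_{n\to\infty}\frac{\max_{0\le j\le n}|x(j)|}{\max_{1\le j\le n}|H(j)|}=1.$$ (ii) For each $n\geq 1$ let $t_n^x\in\{0,\dots,n\}$ and $t_n^H\in\{1,\dots,n\}$ be such that $|x(t_n^x)|=\max_{0\le j\le n}|x(j)|$ and $|H(t_n^H)|=\max_{1\le j\le n}|H(j)|$. Then (a) $$\lim_{n\to\infty}\frac{|x(t_n^H)|}{|H(t_n^H)|}=1,\qquad \lim_{n\to\infty}\frac{|x(t_n^x)|}{|x(t_n^H)|}=1;$$ (b) $$\lim_{n\to\infty}\frac{|x(t_n^x)|}{|H(t_n^x)|}=1,\qquad \lim_{n\to\infty}\frac{|H(t_n^x)|}{|H(t_n^H)|}=1.$$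
   Context: Limits of ratios are understood for all $n$ sufficiently large that the quantities in them are defined (in particular $H(t_n^x)$ is considered only when $t_n^x\ge 1$). *)

theory Defs
  imports "HOL-Analysis.Analysis"
begin

end

theory Submission
  imports Defs
begin

text \<open>The recurrence says that \<open>x - H\<close> is the convolution of the summable kernel \<open>k\<close> with
  \<open>f \<circ> x\<close>. Because \<open>f\<close> is sublinear, it satisfies \<open>\<bar>f u\<bar> \<le> C + \<epsilon> \<bar>u\<bar>\<close> for every \<open>\<epsilon> > 0\<close>
  and suitable \<open>C\<close>, so the convolution is at most \<open>\<eta> X n + D\<close> up to time \<open>n\<close>, where \<open>X n\<close> is
  the running maximum of \<open>\<bar>x\<bar>\<close> and \<open>\<eta>\<close> is as small as desired
  (\<open>convolution_sublinear_bound\<close>). Taking \<open>\<eta> = 1\<close> shows that \<open>X\<close> is unbounded, since \<open>H\<close> is.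
  The constant \<open>D\<close> is then negligible, and \<open>\<bar>x j\<bar>\<close> and \<open>\<bar>H j\<bar>\<close> differ by \<open>o(X n)\<close> uniformly in
  \<open>1 \<le> j \<le> n\<close>. There is no comparison at time 0, but \<open>\<bar>x\<bar>\<close> is
  not maximal there once \<open>X n > \<bar>x 0\<bar>\<close>.

  Everything else follows from this uniform comparison. The running maximum of \<open>\<bar>H\<bar>\<close>, the value
  of \<open>\<bar>H\<bar>\<close> where \<open>\<bar>x\<bar>\<close> is largest and the value of \<open>\<bar>x\<bar>\<close> where \<open>\<bar>H\<bar>\<close> is largest are each
  \<open>X n + o(X n)\<close>, so any two of them have ratio tending to 1.\<close>

text \<open>Outside a large ball the limit gives the linear part of the bound; inside it \<open>f\<close> is bounded
  by compactness.\<close>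

lemma sublinear_bound:
  fixes f :: "real \<Rightarrow> real"
  assumes cont: "continuous_on UNIV f"
    and lim: "((\<lambda>u. f u / u) \<longlongrightarrow> 0) at_infinity"
    and \<epsilon>: "\<epsilon> > 0"
  obtains C where "C \<ge> 0" "\<And>u. \<bar>f u\<bar> \<le> C + \<epsilon> * \<bar>u\<bar>"
proof -
  have "eventually (\<lambda>u. \<bar>f u / u\<bar> < \<epsilon>) at_infinity"
    using tendstoD[OF lim \<epsilon>] by (simp add: dist_real_def)
  then obtain b where b: "\<And>u. \<bar>u\<bar> \<ge> b \<Longrightarrow> \<bar>f u / u\<bar> < \<epsilon>"
    unfolding eventually_at_infinity by auto
  have "compact (f ` cball 0 \<bar>b\<bar>)"
    by (intro compact_continuous_image continuous_on_subset[OF cont]) auto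
  then obtain C where C: "C > 0" "\<And>u. \<bar>u\<bar> \<le> \<bar>b\<bar> \<Longrightarrow> \<bar>f u\<bar> \<le> C"
    using bounded_pos[of "f ` cball 0 \<bar>b\<bar>"] compact_imp_bounded by (auto simp: dist_real_def)
  have "\<bar>f u\<bar> \<le> C + \<epsilon> * \<bar>u\<bar>" for u
  proof (cases "\<bar>u\<bar> \<le> \<bar>b\<bar>")
    case True
    moreover have "0 \<le> \<epsilon> * \<bar>u\<bar>" using \<epsilon> by simp
    ultimately show ?thesis using C(2)[of u] by linarith
  next
    case False
    then have "\<bar>f u\<bar> < \<epsilon> * \<bar>u\<bar>"
      using b[of u] by (simp add: abs_divide divide_less_eq)
    then show ?thesis using C(1) by linarith
  qed
  then show thesis using that C(1) by (meson less_imp_le)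
qed

text \<open>A discrete form of Young's inequality between the sum and supremum norms, with the
  supremum of the second factor taken only over the indices that occur.\<close>

lemma abs_convolution_le:
  fixes k g :: "nat \<Rightarrow> real"
  assumes "summable (\<lambda>j. \<bar>k j\<bar>)" and M: "\<And>j. j \<le> n \<Longrightarrow> \<bar>g j\<bar> \<le> M"
  shows "\<bar>\<Sum>j=0..n. k (n - j) * g j\<bar> \<le> (\<Sum>j. \<bar>k j\<bar>) * M"
proof -
  have "0 \<le> M" using M[of 0] by simp
  have "\<bar>\<Sum>j=0..n. k (n - j) * g j\<bar> \<le> (\<Sum>j=0..n. \<bar>k (n - j)\<bar> * M)"
    by (rule order_trans[OF sum_abs sum_mono]) (auto simp: abs_mult intro: mult_left_mono M)
  also have "\<dots> = (\<Sum>j\<in>{0..n}. \<bar>k j\<bar>) * M"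
    using sum.nat_diff_reindex[of "\<lambda>j. \<bar>k j\<bar>" "Suc n"]
    by (simp add: atLeast0AtMost lessThan_Suc_atMost flip: sum_distrib_right)
  also have "\<dots> \<le> (\<Sum>j. \<bar>k j\<bar>) * M"
    using assms(1) \<open>0 \<le> M\<close> by (intro mult_right_mono sum_le_suminf) auto
  finally show ?thesis .
qed

text \<open>The quantitative core: the bound is uniform up to time \<open>n\<close> and its slope \<open>\<eta>\<close> is arbitrary,
  at the price of the constant \<open>D\<close>.\<close>

lemma convolution_sublinear_bound:
  fixes f :: "real \<Rightarrow> real" and k H x :: "nat \<Rightarrow> real"
  assumes "continuous_on UNIV f"
    and "((\<lambda>u. f u / u) \<longlongrightarrow> 0) at_infinity"
    and k: "summable (\<lambda>j. \<bar>k j\<bar>)"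
    and x: "\<And>n. x (n + 1) = H (n + 1) + (\<Sum>j=0..n. k (n - j) * f (x j))"
    and \<eta>: "\<eta> > 0"
  obtains D where
    "\<And>n j. j \<in> {1..n} \<Longrightarrow> \<bar>x j - H j\<bar> \<le> \<eta> * (MAX i\<in>{0..n}. \<bar>x i\<bar>) + D"
proof -
  define K where "K = (\<Sum>j. \<bar>k j\<bar>)"
  have K: "0 \<le> K" unfolding K_def by (intro suminf_nonneg k) auto
  (* The denominator is shifted by 1 because K may vanish. *)
  define \<epsilon> where "\<epsilon> = \<eta> / (K + 1)"
  have \<epsilon>: "\<epsilon> > 0" "K * \<epsilon> \<le> \<eta>"
    unfolding \<epsilon>_def using K \<eta> by (auto simp: field_simps)
  obtain C where C: "\<And>u. \<bar>f u\<bar> \<le> C + \<epsilon> * \<bar>u\<bar>"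
    using sublinear_bound[OF assms(1,2) \<epsilon>(1)] by blast
  have "\<bar>x j - H j\<bar> \<le> \<eta> * (MAX i\<in>{0..n}. \<bar>x i\<bar>) + K * C" if "j \<in> {1..n}" for n j
  proof -
    define X where "X = (MAX i\<in>{0..n}. \<bar>x i\<bar>)"
    have X: "\<bar>x i\<bar> \<le> X" if "i \<le> n" for i
      unfolding X_def using that by (intro Max_ge) auto
    have "0 \<le> X" using X[of 0] by simp
    obtain m where m: "j = m + 1" "m < n"
      using \<open>j \<in> {1..n}\<close> by (cases j) auto
    have "\<bar>f (x i)\<bar> \<le> C + \<epsilon> * X" if "i \<le> m" for i
    proof -
      have "\<epsilon> * \<bar>x i\<bar> \<le> \<epsilon> * X" using X[of i] that m \<epsilon>(1) by (intro mult_left_mono) auto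
      then show ?thesis using C[of "x i"] by linarith
    qed
    then have "\<bar>x j - H j\<bar> \<le> K * (C + \<epsilon> * X)"
      using abs_convolution_le[OF k, of m "\<lambda>i. f (x i)"] x[of m] m(1)
      by (simp add: K_def)
    also have "\<dots> = K * \<epsilon> * X + K * C" by (simp add: algebra_simps)
    also have "\<dots> \<le> \<eta> * X + K * C" using \<epsilon>(2) \<open>0 \<le> X\<close> by (simp add: mult_right_mono)
    finally show ?thesis unfolding X_def .
  qed
  then show thesis using that by blast
qed

lemma tendsto_ratio_1I:
  fixes a b :: "nat \<Rightarrow> real"
  assumes pos: "eventually (\<lambda>n. b n > 0) sequentially"
    and close: "\<And>\<eta>. \<eta> > 0 \<Longrightarrow> eventually (\<lambda>n. \<bar>a n - b n\<bar> \<le> \<eta> * b n) sequentially"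
  shows "(\<lambda>n. a n / b n) \<longlonglongrightarrow> 1"
proof (rule tendstoI)
  fix \<epsilon> :: real assume "\<epsilon> > 0"
  then have "eventually (\<lambda>n. \<bar>a n - b n\<bar> \<le> \<epsilon> / 2 * b n) sequentially"
    by (intro close) simp
  with pos show "eventually (\<lambda>n. dist (a n / b n) 1 < \<epsilon>) sequentially"
  proof eventually_elim
    case (elim n)
    have "dist (a n / b n) 1 = \<bar>a n - b n\<bar> / b n"
      using elim(1) by (simp add: dist_real_def divide_diff_eq_iff)
    also have "\<dots> \<le> \<epsilon> / 2" using elim by (simp add: pos_divide_le_eq)
    also have "\<dots> < \<epsilon>" using \<open>\<epsilon> > 0\<close> by simp
    finally show ?case .
  qed
qed

lemma tendsto_ratio_1_trans:
  fixes a b c :: "nat \<Rightarrow> real"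
  assumes "(\<lambda>n. a n / c n) \<longlonglongrightarrow> 1" "(\<lambda>n. b n / c n) \<longlonglongrightarrow> 1"
    and "eventually (\<lambda>n. c n > 0) sequentially"
  shows "(\<lambda>n. a n / b n) \<longlonglongrightarrow> 1"
proof -
  have "(\<lambda>n. (a n / c n) / (b n / c n)) \<longlonglongrightarrow> 1"
    using tendsto_divide[OF assms(1,2)] by simp
  moreover have "eventually (\<lambda>n. (a n / c n) / (b n / c n) = a n / b n) sequentially"
    using assms(3) by eventually_elim simp
  ultimately show ?thesis by (rule Lim_transform_eventually)
qed

theorem theorem2:
  fixes f :: "real \<Rightarrow> real" and k H x :: "nat \<Rightarrow> real" and \<xi> :: real
  assumes "continuous_on UNIV f"
    and "((\<lambda>u. f u / u) \<longlongrightarrow> 0) at_infinity"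
    and "summable (\<lambda>j. \<bar>k j\<bar>)"
    and "x 0 = \<xi>"
    and "\<And>n. x (n + 1) = H (n + 1) + (\<Sum>j=0..n. k (n - j) * f (x j))"
    and "filterlim (\<lambda>n. MAX j\<in>{1..n}. \<bar>H j\<bar>) at_top sequentially"
  shows "(filterlim (\<lambda>n. MAX j\<in>{0..n}. \<bar>x j\<bar>) at_top sequentially \<and>
          (\<lambda>n. (MAX j\<in>{0..n}. \<bar>x j\<bar>) / (MAX j\<in>{1..n}. \<bar>H j\<bar>)) \<longlonglongrightarrow> 1) \<and>
         (\<forall>tx tH :: nat \<Rightarrow> nat.
           (\<forall>n\<ge>1. tx n \<in> {0..n} \<and> \<bar>x (tx n)\<bar> = (MAX j\<in>{0..n}. \<bar>x j\<bar>) \<and>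
                  tH n \<in> {1..n} \<and> \<bar>H (tH n)\<bar> = (MAX j\<in>{1..n}. \<bar>H j\<bar>)) \<longrightarrow>
           ((\<lambda>n. \<bar>x (tH n)\<bar> / \<bar>H (tH n)\<bar>) \<longlonglongrightarrow> 1 \<and>
            (\<lambda>n. \<bar>x (tx n)\<bar> / \<bar>x (tH n)\<bar>) \<longlonglongrightarrow> 1) \<and>
           ((\<lambda>n. \<bar>x (tx n)\<bar> / \<bar>H (tx n)\<bar>) \<longlonglongrightarrow> 1 \<and>
            (\<lambda>n. \<bar>H (tx n)\<bar> / \<bar>H (tH n)\<bar>) \<longlonglongrightarrow> 1))"
proof -
  define X where "X = (\<lambda>n. MAX j\<in>{0..n}. \<bar>x j\<bar>)"
  define h where "h = (\<lambda>n. MAX j\<in>{1..n}. \<bar>H j\<bar>)"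
  have X_ge: "\<bar>x j\<bar> \<le> X n" if "j \<in> {0..n}" for j n
    unfolding X_def using that by (intro Max_ge) auto
  have h_ge: "\<bar>H j\<bar> \<le> h n" if "j \<in> {1..n}" for j n
    unfolding h_def using that by (intro Max_ge) auto
  have X_attained: "\<exists>j\<in>{0..n}. X n = \<bar>x j\<bar>" for n
  proof -
    have "X n \<in> (\<lambda>j. \<bar>x j\<bar>) ` {0..n}" unfolding X_def by (intro Max_in) auto
    then show ?thesis by blast
  qed
  have h_attained: "\<exists>j\<in>{1..n}. h n = \<bar>H j\<bar>" if "n \<ge> 1" for n
  proof -
    have "h n \<in> (\<lambda>j. \<bar>H j\<bar>) ` {1..n}" unfolding h_def using that by (intro Max_in) auto
    then show ?thesis by blast
  qed
  have h_at_top: "filterlim h at_top sequentially"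
    using assms(6) unfolding h_def .

  have X_at_top: "filterlim X at_top sequentially"
  proof -
    obtain D where D: "\<And>n j. j \<in> {1..n} \<Longrightarrow> \<bar>x j - H j\<bar> \<le> 1 * X n + D"
      using convolution_sublinear_bound[OF assms(1-3,5), of 1] unfolding X_def by auto
    have "h n \<le> 2 * X n + D" if n: "n \<ge> 1" for n
    proof -
      obtain j where j: "j \<in> {1..n}" "h n = \<bar>H j\<bar>" using h_attained[OF n] by blast
      then show ?thesis using D[OF j(1)] X_ge[of j n] by auto
    qed
    then have "eventually (\<lambda>n. (h n - D) / 2 \<le> X n) sequentially"
      by (intro eventually_sequentiallyI[of 1]) (simp add: field_simps)
    moreover have "filterlim (\<lambda>n. (h n - D) / 2) at_top sequentially"
      using filterlim_tendsto_pos_mult_at_top[OF tendsto_const[of "1/2"] _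
          filterlim_tendsto_add_at_top[OF tendsto_const[of "-D"] h_at_top]]
      by (simp add: algebra_simps diff_divide_distrib)
    ultimately show ?thesis by (rule filterlim_at_top_mono[rotated])
  qed
  then have X_gt: "eventually (\<lambda>n. X n > c) sequentially" for c
    by (simp add: filterlim_at_top_dense)

  have close: "eventually (\<lambda>n. \<forall>j\<in>{1..n}. \<bar>\<bar>x j\<bar> - \<bar>H j\<bar>\<bar> \<le> \<eta> * X n) sequentially"
    if "\<eta> > 0" for \<eta>
  proof -
    obtain D where D: "\<And>n j. j \<in> {1..n} \<Longrightarrow> \<bar>x j - H j\<bar> \<le> \<eta> / 2 * X n + D"
      using convolution_sublinear_bound[OF assms(1-3,5), of "\<eta> / 2"] \<open>\<eta> > 0\<close>
      unfolding X_def by auto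
    (* Half of the slope is spent on absorbing D. *)
    show ?thesis using X_gt[of "D / (\<eta> / 2)"]
    proof eventually_elim
      case (elim n)
      then have "D < \<eta> / 2 * X n" using \<open>\<eta> > 0\<close> by (simp add: field_simps)
      then have "\<bar>x j - H j\<bar> \<le> \<eta> * X n" if "j \<in> {1..n}" for j
        using D[OF that] by (simp add: field_simps)
      then show ?case by (meson abs_triangle_ineq3 order_trans)
    qed
  qed

  have max_close: "eventually (\<lambda>n. \<bar>h n - X n\<bar> \<le> \<eta> * X n) sequentially" if "\<eta> > 0" for \<eta>
    using close[OF that] X_gt[of "\<bar>x 0\<bar>"] eventually_ge_at_top[of 1]
  proof eventually_elim
    case (elim n)
    obtain i where i: "i \<in> {0..n}" "X n = \<bar>x i\<bar>" using X_attained by blast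
    have "i \<noteq> 0" using i(2) elim(2) by (cases "i = 0") auto
    then have i': "i \<in> {1..n}" using i(1) by auto
    obtain j where j: "j \<in> {1..n}" "h n = \<bar>H j\<bar>" using h_attained[OF elim(3)] by blast
    have "\<bar>X n - \<bar>H i\<bar>\<bar> \<le> \<eta> * X n" "\<bar>\<bar>x j\<bar> - h n\<bar> \<le> \<eta> * X n"
      using elim(1) i' i(2) j by auto
    moreover have "\<bar>x j\<bar> \<le> X n" "\<bar>H i\<bar> \<le> h n"
      using X_ge[of j n] h_ge[OF i'] j(1) by auto
    ultimately show ?case
      unfolding abs_le_iff by argo
  qed
  have h_ratio: "(\<lambda>n. h n / X n) \<longlonglongrightarrow> 1"
    by (rule tendsto_ratio_1I[OF X_gt max_close])
  have X_self: "(\<lambda>n. X n / X n) \<longlonglongrightarrow> 1"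
    by (rule tendsto_ratio_1I[OF X_gt]) (use X_gt[of 0] in \<open>eventually_elim, simp\<close>)
  note ratio = tendsto_ratio_1_trans[OF _ _ X_gt[of 0]]

  have argmax: "((\<lambda>n. \<bar>x (tH n)\<bar> / \<bar>H (tH n)\<bar>) \<longlonglongrightarrow> 1 \<and>
        (\<lambda>n. \<bar>x (tx n)\<bar> / \<bar>x (tH n)\<bar>) \<longlonglongrightarrow> 1) \<and>
       ((\<lambda>n. \<bar>x (tx n)\<bar> / \<bar>H (tx n)\<bar>) \<longlonglongrightarrow> 1 \<and>
        (\<lambda>n. \<bar>H (tx n)\<bar> / \<bar>H (tH n)\<bar>) \<longlonglongrightarrow> 1)"
    if t: "\<And>n. n \<ge> 1 \<Longrightarrow> tx n \<in> {0..n} \<and> \<bar>x (tx n)\<bar> = X n \<and>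
                          tH n \<in> {1..n} \<and> \<bar>H (tH n)\<bar> = h n"
    for tx tH :: "nat \<Rightarrow> nat"
  proof -
    have Hx: "(\<lambda>n. \<bar>H (tx n)\<bar> / X n) \<longlonglongrightarrow> 1"
    proof (rule tendsto_ratio_1I[OF X_gt])
      fix \<eta> :: real assume "\<eta> > 0"
      show "eventually (\<lambda>n. \<bar>\<bar>H (tx n)\<bar> - X n\<bar> \<le> \<eta> * X n) sequentially"
        using close[OF \<open>\<eta> > 0\<close>] X_gt[of "\<bar>x 0\<bar>"] eventually_ge_at_top[of 1]
      proof eventually_elim
        case (elim n)
        note tn = t[OF elim(3)]
        have "tx n \<noteq> 0" using tn elim(2) by (cases "tx n = 0") auto
        then have "tx n \<in> {1..n}" using tn by auto
        from bspec[OF elim(1) this] show ?case using tn by linarith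
      qed
    qed
    have xH: "(\<lambda>n. \<bar>x (tH n)\<bar> / X n) \<longlonglongrightarrow> 1"
    proof (rule tendsto_ratio_1I[OF X_gt])
      fix \<eta> :: real assume "\<eta> > 0"
      then have "\<eta> / 2 > 0" by simp
      from close[OF this] max_close[OF this] eventually_ge_at_top[of 1]
      show "eventually (\<lambda>n. \<bar>\<bar>x (tH n)\<bar> - X n\<bar> \<le> \<eta> * X n) sequentially"
      proof eventually_elim
        case (elim n)
        note tn = t[OF elim(3)]
        then have "\<bar>\<bar>x (tH n)\<bar> - h n\<bar> \<le> \<eta> / 2 * X n" using elim(1) by metis
        then have "\<bar>\<bar>x (tH n)\<bar> - X n\<bar> \<le> \<eta> / 2 * X n + \<eta> / 2 * X n"
          using elim(2) by linarith
        then show ?case by simp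
      qed
    qed
    have xx: "(\<lambda>n. \<bar>x (tx n)\<bar> / X n) \<longlonglongrightarrow> 1"
      by (rule Lim_transform_eventually[OF X_self eventually_sequentiallyI[of 1]]) (simp add: t)
    have HH: "(\<lambda>n. \<bar>H (tH n)\<bar> / X n) \<longlonglongrightarrow> 1"
      by (rule Lim_transform_eventually[OF h_ratio eventually_sequentiallyI[of 1]]) (simp add: t)
    show ?thesis
      using ratio[OF xH HH] ratio[OF xx xH] ratio[OF xx Hx] ratio[OF Hx HH] by simp
  qed
  have "(\<lambda>n. X n / h n) \<longlonglongrightarrow> 1" by (rule ratio[OF X_self h_ratio])
  with X_at_top show ?thesis
    unfolding fun_cong[OF X_def, symmetric] fun_cong[OF h_def, symmetric]
    by (intro conjI[OF conjI] allI impI argmax) simp_all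
qed

end
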